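(* Let $m\ge 3$ be an integer with $m\ne 4$, let $n\ge 1$ be an integer, and let $M_{2mn}=\langle a,b : a^m=b^{2n}=1,\ bab^{-1}=a^{-1}\rangle$. Then each of the graphs $\Gamma=\mathrm{ESCom}(M_{2mn})$, $\Gamma=\mathrm{CSCom}(M_{2mn})$ and $\Gamma=\mathrm{OSCom}(M_{2mn})$ satisfies the Hansen--Vukičević inequality \[ \frac{M_2(\Gamma)}{|e(\Gamma)|}\ \ge\ \frac{M_1(\Gamma)}{|v(\Gamma)|}. \]
   Context: For an equivalence relation $B$ on a finite group $G$, with $[g]$ the class of $g$, the $B$ super commuting graph of $G$ is the simple graph with vertex set $G$ in which two distinct vertices $g,h$ are adjacent if and only if $[g]=[h]$ or there exist $g'\in[g]$, $h'\in[h]$ with $g'h'=h'g'$. It is denoted $\mathrm{ESCom}(G)$ when $B$ is equality (so $g\ne h$ are adjacent iff $gh=hg$), $\mathrm{CSCom}(G)$ when $B$ is conjugacy in $G$, and $\mathrm{OSCom}(G)$ when $B$ is the relation of having the same order. For a finite simple graph $\Gamma$ with vertex set $v(\Gamma)$ and edge set $e(\Gamma)$, the first and second Zagreb indices are $M_1(\Gamma)=\sum_{v\in v(\Gamma)}\deg(v)^2$ and $M_2(\Gamma)=\sum_{uv\in e(\Gamma)}\deg(u)\deg(v)$. *)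

theory Defs
  imports Complex_Main "HOL-Algebra.Multiplicative_Group"
begin

section \<open>Groups given by generators and relations\<close>

datatype 'g letter = Gen 'g | Inv 'g

fun inv_letter :: "'g letter \<Rightarrow> 'g letter" where
  "inv_letter (Gen x) = Inv x"
| "inv_letter (Inv x) = Gen x"

text \<open>A pair \<open>(u, v) \<in> R\<close> stands for the defining relation \<open>u = v\<close>.\<close>

inductive word_eq :: "('g letter list \<times> 'g letter list) set \<Rightarrow> 'g letter list \<Rightarrow> 'g letter list \<Rightarrow> bool"
  for R where
  refl: "word_eq R u u"
| sym: "word_eq R u v \<Longrightarrow> word_eq R v u"
| trans: "word_eq R u v \<Longrightarrow> word_eq R v w \<Longrightarrow> word_eq R u w"
| cong: "word_eq R u v \<Longrightarrow> word_eq R (xs @ u @ ys) (xs @ v @ ys)"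
| cancel: "word_eq R [x, inv_letter x] []"
| rel: "(u, v) \<in> R \<Longrightarrow> word_eq R u v"

definition word_rel :: "('g letter list \<times> 'g letter list) set \<Rightarrow> ('g letter list \<times> 'g letter list) set" where
  "word_rel R = {(u, v). word_eq R u v}"

text \<open>The generating set is the whole type \<open>'g\<close>.\<close>

definition presented_group :: "('g letter list \<times> 'g letter list) set \<Rightarrow> 'g letter list set monoid" where
  "presented_group R =
     \<lparr>carrier = UNIV // word_rel R,
      mult = (\<lambda>A B. \<Union>u\<in>A. \<Union>v\<in>B. word_rel R `` {u @ v}),
      one = word_rel R `` {[]}\<rparr>"

lemma equiv_word_rel: "equiv UNIV (word_rel R)"
  by (rule equivI)
    (auto simp: word_rel_def refl_on_def sym_def trans_def
      intro: word_eq.refl word_eq.sym word_eq.trans)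

lemma word_eq_append:
  assumes "word_eq R u u'" "word_eq R v v'"
  shows "word_eq R (u @ v) (u' @ v')"
  using word_eq.trans[OF word_eq.cong[OF assms(1), of "[]" v] ] 
    word_eq.cong[OF assms(2), of u' "[]"] by simp

lemma presented_group_mult:
  "mult (presented_group R) (word_rel R `` {u}) (word_rel R `` {v}) = word_rel R `` {u @ v}"
proof -
  have "congruent2 (word_rel R) (word_rel R) (\<lambda>u v. word_rel R `` {u @ v})"
    by (rule congruent2I') (rule equiv_class_eq[OF equiv_word_rel],
      simp add: word_rel_def word_eq_append)
  from UN_equiv_class2[OF equiv_word_rel equiv_word_rel this]
  show ?thesis by (simp add: presented_group_def)
qed

lemma word_eq_inverse: "word_eq R (map inv_letter (rev w) @ w) []"
proof (induction w)
  case Nil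
  show ?case by (simp add: word_eq.refl)
next
  case (Cons x w)
  have "inv_letter (inv_letter x) = x" by (cases x) auto
  then have "word_eq R [inv_letter x, x] []" using word_eq.cancel[of R "inv_letter x"] by simp
  from word_eq.cong[OF this, of "map inv_letter (rev w)" w] Cons
  show ?case by (auto intro: word_eq.trans)
qed

lemma group_presented_group: "group (presented_group R)"
proof (rule groupI)
  have car: "A \<in> carrier (presented_group R) \<longleftrightarrow> (\<exists>u. A = word_rel R `` {u})" for A
    by (auto simp: presented_group_def quotient_def)
  have one: "one (presented_group R) = word_rel R `` {[]}"
    by (simp add: presented_group_def)
  show "one (presented_group R) \<in> carrier (presented_group R)"
    using car one by blast
  fix A assume "A \<in> carrier (presented_group R)"
  then obtain u where A: "A = word_rel R `` {u}" using car by blast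
  show "mult (presented_group R) (one (presented_group R)) A = A"
    by (simp add: A one presented_group_mult)
  have "word_rel R `` {map inv_letter (rev u) @ u} = word_rel R `` {[]}"
    by (rule equiv_class_eq[OF equiv_word_rel]) (simp add: word_rel_def word_eq_inverse)
  then show "\<exists>B\<in>carrier (presented_group R).
      mult (presented_group R) B A = one (presented_group R)"
    using car by (metis A one presented_group_mult)
  fix B assume "B \<in> carrier (presented_group R)"
  then obtain v where B: "B = word_rel R `` {v}" using car by blast
  show "mult (presented_group R) A B \<in> carrier (presented_group R)"
    using car A B presented_group_mult by blast
  fix C assume "C \<in> carrier (presented_group R)"
  then obtain w where C: "C = word_rel R `` {w}" using car by blast
  show "mult (presented_group R) (mult (presented_group R) A B) C
      = mult (presented_group R) A (mult (presented_group R) B C)"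
    by (simp add: A B C presented_group_mult)
qed

datatype gen_ab = gen_a | gen_b

definition M_group :: "nat \<Rightarrow> nat \<Rightarrow> gen_ab letter list set monoid" where
  "M_group m n = presented_group
     {(replicate m (Gen gen_a), []),
      (replicate (2 * n) (Gen gen_b), []),
      ([Gen gen_b, Gen gen_a, Inv gen_b], [Inv gen_a])}"

section \<open>Finite simple graphs and Zagreb indices\<close>

text \<open>A simple graph is a pair of a vertex set and a set of two-element sets of vertices.\<close>

type_synonym 'v sgraph = "'v set \<times> 'v set set"

definition verts :: "'v sgraph \<Rightarrow> 'v set" where
  "verts \<Gamma> = fst \<Gamma>"

definition edges :: "'v sgraph \<Rightarrow> 'v set set" where
  "edges \<Gamma> = snd \<Gamma>"

definition degree :: "'v sgraph \<Rightarrow> 'v \<Rightarrow> nat" where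
  "degree \<Gamma> v = card {e \<in> edges \<Gamma>. v \<in> e}"

definition zagreb1 :: "'v sgraph \<Rightarrow> nat" where
  "zagreb1 \<Gamma> = (\<Sum>v\<in>verts \<Gamma>. (degree \<Gamma> v)\<^sup>2)"

text \<open>An edge \<open>e\<close> is the set of its two end points, so the inner product is \<open>deg u * deg v\<close> for
  \<open>e = {u, v}\<close>.\<close>

definition zagreb2 :: "'v sgraph \<Rightarrow> nat" where
  "zagreb2 \<Gamma> = (\<Sum>e\<in>edges \<Gamma>. \<Prod>v\<in>e. degree \<Gamma> v)"

definition hansen_vukicevic :: "'v sgraph \<Rightarrow> bool" where
  "hansen_vukicevic \<Gamma> \<longleftrightarrow>
     real (zagreb2 \<Gamma>) / real (card (edges \<Gamma>)) \<ge> real (zagreb1 \<Gamma>) / real (card (verts \<Gamma>))"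

section \<open>Super commuting graphs\<close>

text \<open>\<open>B\<close> is meant to be an equivalence relation on \<open>carrier G\<close>; the class of \<open>g\<close> is \<open>B `` {g}\<close>.\<close>

definition super_commuting_graph :: "('a, 'b) monoid_scheme \<Rightarrow> ('a \<times> 'a) set \<Rightarrow> 'a sgraph" where
  "super_commuting_graph G B =
     (carrier G,
      {{g, h} | g h. g \<in> carrier G \<and> h \<in> carrier G \<and> g \<noteq> h \<and>
         (B `` {g} = B `` {h} \<or>
          (\<exists>g'\<in>B `` {g}. \<exists>h'\<in>B `` {h}. g' \<otimes>\<^bsub>G\<^esub> h' = h' \<otimes>\<^bsub>G\<^esub> g'))})"

definition conjugacy_rel :: "('a, 'b) monoid_scheme \<Rightarrow> ('a \<times> 'a) set" where
  "conjugacy_rel G =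
     {(g, h). g \<in> carrier G \<and> h \<in> carrier G \<and>
        (\<exists>x\<in>carrier G. h = x \<otimes>\<^bsub>G\<^esub> g \<otimes>\<^bsub>G\<^esub> inv\<^bsub>G\<^esub> x)}"

definition same_order_rel :: "('a, 'b) monoid_scheme \<Rightarrow> ('a \<times> 'a) set" where
  "same_order_rel G =
     {(g, h). g \<in> carrier G \<and> h \<in> carrier G \<and> group.ord G g = group.ord G h}"

lemma (in group) equiv_conjugacy_rel: "equiv (carrier G) (conjugacy_rel G)"
proof (rule equivI)
  show "conjugacy_rel G \<subseteq> carrier G \<times> carrier G"
    by (auto simp: conjugacy_rel_def)
  show "refl_on (carrier G) (conjugacy_rel G)"
    by (force simp: conjugacy_rel_def refl_on_def intro: bexI[of _ \<one>])
  show "sym (conjugacy_rel G)"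
  proof (rule symI)
    fix g h assume "(g, h) \<in> conjugacy_rel G"
    then obtain x where x: "g \<in> carrier G" "x \<in> carrier G" "h = x \<otimes> g \<otimes> inv x" "h \<in> carrier G"
      by (auto simp: conjugacy_rel_def)
    then have "g = inv x \<otimes> h \<otimes> inv (inv x)"
      by (metis inv_closed inv_inv inv_solve_left inv_solve_right m_assoc m_closed)
    then show "(h, g) \<in> conjugacy_rel G"
      using x by (auto simp: conjugacy_rel_def intro!: bexI[of _ "inv x"])
  qed
  show "trans (conjugacy_rel G)"
  proof (rule transI)
    fix g h k assume "(g, h) \<in> conjugacy_rel G" "(h, k) \<in> conjugacy_rel G"
    then obtain x y where x: "g \<in> carrier G" "x \<in> carrier G" "h = x \<otimes> g \<otimes> inv x"
      and y: "y \<in> carrier G" "k = y \<otimes> h \<otimes> inv y" "k \<in> carrier G"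
      by (auto simp: conjugacy_rel_def)
    then have "k = (y \<otimes> x) \<otimes> g \<otimes> inv (y \<otimes> x)"
      by (simp add: inv_mult_group m_assoc)
    then show "(g, k) \<in> conjugacy_rel G"
      using x y unfolding conjugacy_rel_def by blast
  qed
qed

lemma equiv_same_order_rel: "equiv (carrier G) (same_order_rel G)"
  by (rule equivI) (auto simp: same_order_rel_def refl_on_def sym_def trans_def)

definition ESCom :: "('a, 'b) monoid_scheme \<Rightarrow> 'a sgraph" where
  "ESCom G = super_commuting_graph G (Id_on (carrier G))"

definition CSCom :: "('a, 'b) monoid_scheme \<Rightarrow> 'a sgraph" where
  "CSCom G = super_commuting_graph G (conjugacy_rel G)"

definition OSCom :: "('a, 'b) monoid_scheme \<Rightarrow> 'a sgraph" where
  "OSCom G = super_commuting_graph G (same_order_rel G)"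

end

theory Submission
  imports Defs
begin

text \<open>
Every element of \<open>M\<^sub>2\<^sub>m\<^sub>n\<close> is \<open>a\<^sup>i b\<^sup>j\<close> with \<open>i\<close> unique modulo \<open>m\<close> and \<open>j\<close> unique modulo \<open>2 n\<close>. The elements with even
\<open>j\<close> form an abelian subgroup \<open>A\<close> of index two that contains the centre \<open>Z\<close>, and no element of \<open>A - Z\<close>
commutes with an element outside \<open>A\<close>. Therefore each of the three graphs is a join of a complete graph
\<open>K\<^sub>z\<close> of dominating vertices with a disjoint union of complete graphs: one, \<open>K\<^sub>p\<close>, is what remains of \<open>A\<close>, and
\<open>r\<close> others, of equal size \<open>q\<close>, cover what remains outside \<open>A\<close> (\<open>super_commuting_graph_joined_cliques\<close>). The
graphs differ in which vertices dominate and in how the elements outside \<open>A\<close> are linked.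

For such a join the Hansen-Vukicevic inequality is a polynomial inequality in \<open>z\<close>, \<open>p\<close>, \<open>r\<close>, \<open>q\<close>
(\<open>hansen_vukicevic_joined_cliques\<close>), and three cases suffice. Let \<open>k\<close> be the order of \<open>a\<close> modulo \<open>Z\<close>, which is
at least \<open>3\<close> because \<open>m \<ge> 3\<close> and \<open>m \<noteq> 4\<close>.

\<^item> If \<open>r = 1\<close>, the inequality holds for all sizes with \<open>z \<ge> 1\<close>. This covers the order relation, where the
  number of dominating vertices varies with the arithmetic of \<open>m\<close> and \<open>n\<close>, and the conjugacy
  relation for odd \<open>k\<close>.
\<^item> For equality, \<open>z\<close> is the order of the centre, \<open>p = (k - 1) z\<close>, \<open>r = k\<close> and \<open>q = z\<close>.
\<^item> For conjugacy with \<open>k = 2 t\<close> even, \<open>z\<close> is again the order of the centre, \<open>p = (2 t - 1) z\<close>, \<open>r = 2\<close> and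
  \<open>q = t z\<close>.
\<close>

section \<open>Graphs of symmetric relations\<close>

definition rel_graph :: "'v set \<Rightarrow> ('v \<Rightarrow> 'v \<Rightarrow> bool) \<Rightarrow> 'v sgraph" where
  "rel_graph V R = (V, {{g, h} | g h. g \<in> V \<and> h \<in> V \<and> g \<noteq> h \<and> R g h})"

lemma verts_rel_graph [simp]: "verts (rel_graph V R) = V"
  by (simp add: rel_graph_def verts_def)

lemma edges_rel_graph:
  "edges (rel_graph V R) = {{g, h} | g h. g \<in> V \<and> h \<in> V \<and> g \<noteq> h \<and> R g h}"
  by (simp add: rel_graph_def edges_def)

lemma rel_graph_cong:
  assumes "\<And>g h. g \<in> V \<Longrightarrow> h \<in> V \<Longrightarrow> g \<noteq> h \<Longrightarrow> R g h \<longleftrightarrow> R' g h"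
  shows "rel_graph V R = rel_graph V R'"
  unfolding rel_graph_def
  by (intro arg_cong2[of _ _ _ _ Pair] HOL.refl Collect_cong ex_cong1) (use assms in blast)

lemma degree_rel_graph:
  assumes "u \<in> V" "\<And>g h. R g h \<Longrightarrow> R h g"
  shows "degree (rel_graph V R) u = card {v \<in> V. v \<noteq> u \<and> R u v}"
proof -
  have "bij_betw (\<lambda>v. {u, v}) {v \<in> V. v \<noteq> u \<and> R u v} {e \<in> edges (rel_graph V R). u \<in> e}"
    unfolding bij_betw_def
  proof
    show "inj_on (\<lambda>v. {u, v}) {v \<in> V. v \<noteq> u \<and> R u v}"
      by (auto simp: inj_on_def doubleton_eq_iff)
    show "(\<lambda>v. {u, v}) ` {v \<in> V. v \<noteq> u \<and> R u v} = {e \<in> edges (rel_graph V R). u \<in> e}"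
      (is "?L = ?S")
    proof
      show "?L \<subseteq> ?S" using assms(1) unfolding edges_rel_graph by blast
      show "?S \<subseteq> ?L"
      proof
        fix e assume "e \<in> ?S"
        then obtain g h where gh: "e = {g, h}" "g \<in> V" "h \<in> V" "g \<noteq> h" "R g h" "u = g \<or> u = h"
          by (auto simp: edges_rel_graph)
        then have "e = {u, g} \<and> R u g \<and> g \<noteq> u \<or> e = {u, h} \<and> R u h \<and> h \<noteq> u"
          using assms(2)[of g h] by blast
        then show "e \<in> ?L" using gh by blast
      qed
    qed
  qed
  then show ?thesis unfolding degree_def by (rule bij_betw_same_card[symmetric])
qed

lemma sum_edges_rel_graph:
  fixes f :: "'v set \<Rightarrow> real"
  assumes fin: "finite V" and sym: "\<And>g h. R g h \<Longrightarrow> R h g"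
  shows "2 * (\<Sum>e\<in>edges (rel_graph V R). f e) = (\<Sum>u\<in>V. \<Sum>v | v \<in> V \<and> v \<noteq> u \<and> R u v. f {u, v})"
proof -
  define S where "S = (SIGMA u:V. {v \<in> V. v \<noteq> u \<and> R u v})"
  define h where "h = (\<lambda>(u :: 'v, v). {u, v})"
  have finS: "finite S" unfolding S_def using fin by auto
  have hS: "h ` S = edges (rel_graph V R)"
  proof
    show "h ` S \<subseteq> edges (rel_graph V R)"
      unfolding h_def S_def edges_rel_graph by auto
    show "edges (rel_graph V R) \<subseteq> h ` S"
    proof
      fix e assume "e \<in> edges (rel_graph V R)"
      then obtain u v where "e = h (u, v)" "(u, v) \<in> S"
        unfolding h_def S_def edges_rel_graph by blast
      then show "e \<in> h ` S" by blast
    qed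
  qed
  have "(\<Sum>u\<in>V. \<Sum>v | v \<in> V \<and> v \<noteq> u \<and> R u v. f {u, v}) = (\<Sum>x\<in>S. f (h x))"
    unfolding S_def h_def by (subst sum.Sigma) (use fin in \<open>auto simp: case_prod_unfold\<close>)
  also have "\<dots> = (\<Sum>e\<in>h ` S. \<Sum>x | x \<in> S \<and> h x = e. f (h x))"
    by (rule sum.image_gen[OF finS])
  \<comment> \<open>each edge is hit by its two orientations\<close>
  also have "\<dots> = (\<Sum>e\<in>h ` S. 2 * f e)"
  proof (rule sum.cong[OF HOL.refl])
    fix e assume "e \<in> h ` S"
    then obtain u v where uv: "e = {u, v}" "u \<in> V" "v \<in> V" "v \<noteq> u" "R u v"
      by (auto simp: h_def S_def)
    have eq: "{x. x \<in> S \<and> h x = e} = {(u, v), (v, u)}"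
      using uv sym[OF uv(5)] by (auto simp: h_def S_def doubleton_eq_iff)
    show "(\<Sum>x | x \<in> S \<and> h x = e. f (h x)) = 2 * f e"
      unfolding eq using uv by (simp add: h_def insert_commute)
  qed
  finally show ?thesis by (simp add: hS sum_distrib_left)
qed

section \<open>Joins with disjoint unions of cliques\<close>

text \<open>The join of \<open>K\<^sub>z\<close> with the disjoint union of \<open>K\<^sub>p\<close> and \<open>r\<close> copies of \<open>K\<^sub>q\<close> has only three vertex degrees,
here \<open>dz\<close>, \<open>dp\<close> and \<open>dq\<close>. With \<open>N\<close> its number of vertices, \<open>e\<close> its number of edges and \<open>M\<^sub>1\<close>, \<open>M\<^sub>2\<close> its Zagreb
indices, the value below is \<open>2 (N M\<^sub>2 - e M\<^sub>1)\<close>: both \<open>2 M\<^sub>2\<close> and \<open>2 e\<close> are sums over the vertices. The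
Hansen-Vukicevic inequality says that it is not negative.\<close>

definition clique_join_gap :: "real \<Rightarrow> real \<Rightarrow> real \<Rightarrow> real \<Rightarrow> real" where
  "clique_join_gap z p r q =
    (let N = z + p + r * q; dz = N - 1; dp = z + p - 1; dq = z + q - 1
     in N * (z * dz * (z * dz + p * dp + r * q * dq - dz) + p * dp * (z * dz + p * dp - dp)
             + r * q * dq * (z * dz + q * dq - dq))
        - (z * dz + p * dp + r * q * dq) * (z * dz\<^sup>2 + p * dp\<^sup>2 + r * q * dq\<^sup>2))"

text \<open>Vertices are labelled by the clique that they belong to: label \<open>0\<close> marks the vertices joined to
everything, label \<open>1\<close> the clique of size \<open>p\<close>, and the labels from \<open>2\<close> on the cliques of size \<open>q\<close>.
Every sum over vertices then collapses to a sum over labels weighted by the clique sizes.\<close>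

lemma hansen_vukicevic_joined_cliques:
  fixes c :: "'v \<Rightarrow> nat" and z p q r :: nat
  assumes fin: "finite V" and lab: "c ` V \<subseteq> {..<r + 2}"
    and z: "card {v \<in> V. c v = 0} = z" and p: "card {v \<in> V. c v = 1} = p"
    and q: "\<And>l. l < r \<Longrightarrow> card {v \<in> V. c v = l + 2} = q"
    and z1: "z \<ge> 1" and V2: "card V \<ge> 2"
    and gap: "clique_join_gap z p r q \<ge> 0"
  shows "hansen_vukicevic (rel_graph V (\<lambda>u v. c u = 0 \<or> c v = 0 \<or> c u = c v))"
proof -
  define R where "R = (\<lambda>u v. c u = 0 \<or> c v = 0 \<or> c u = c v)"
  let ?G = "rel_graph V R"
  have sym: "\<And>u v. R u v \<Longrightarrow> R v u" by (auto simp: R_def)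
  have labs: "{..<r + 2} = insert 0 (insert 1 ((\<lambda>l. l + 2) ` {..<r}))"
  proof -
    have "x \<in> (\<lambda>l. l + 2) ` {..<r}" if "x < r + 2" "x \<noteq> 0" "x \<noteq> 1" for x
      using that by (intro image_eqI[of _ _ "x - 2"]) auto
    then show ?thesis by auto
  qed
  have total: "(\<Sum>v\<in>V. g (c v)) = z * g 0 + p * g 1 + (\<Sum>l<r. q * g (l + 2))"
    for g :: "nat \<Rightarrow> real"
  proof -
    have "(\<Sum>v\<in>V. g (c v)) = (\<Sum>l\<in>{..<r + 2}. \<Sum>v | v \<in> V \<and> c v = l. g (c v))"
      by (rule sum.group[symmetric, OF fin _ lab]) simp
    also have "\<dots> = (\<Sum>l\<in>{..<r + 2}. card {v \<in> V. c v = l} * g l)"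
      by (intro sum.cong) auto
    also have "\<dots> = card {v \<in> V. c v = 0} * g 0 + card {v \<in> V. c v = 1} * g 1
        + (\<Sum>l<r. card {v \<in> V. c v = l + 2} * g (l + 2))"
      unfolding labs by (simp add: sum.reindex inj_on_def image_iff)
    finally show ?thesis using p q by (simp add: z)
  qed
  define N where "N = real z + p + r * q"
  have N: "real (card V) = N"
    using total[of "\<lambda>_. 1"] by (simp add: N_def)
  define k where "k l = real (if l = 0 then 0 else if l = 1 then p else q)" for l :: nat
  have k: "real (card {v \<in> V. c v = l}) = k l" if "l < r + 2" "l \<noteq> 0" for l
  proof (cases "l = 1")
    case False
    then have "l - 2 < r" "l - 2 + 2 = l" using that by auto
    then show ?thesis using q[of "l - 2"] that False by (simp add: k_def)
  qed (simp add: k_def p[simplified])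
  define dg where "dg l = (if l = 0 then N - 1 else z + k l - 1)" for l
  have nbr: "(\<Sum>v | v \<in> V \<and> v \<noteq> u \<and> R u v. g (c v)) =
      (if c u = 0 then (\<Sum>v\<in>V. g (c v)) else z * g 0 + k (c u) * g (c u)) - g (c u)"
    if u: "u \<in> V" for u and g :: "nat \<Rightarrow> real"
  proof -
    have eq: "{v. v \<in> V \<and> v \<noteq> u \<and> R u v} = {v \<in> V. R u v} - {u}" by auto
    have "(\<Sum>v | v \<in> V \<and> v \<noteq> u \<and> R u v. g (c v)) = (\<Sum>v | v \<in> V \<and> R u v. g (c v)) - g (c u)"
      unfolding eq using fin u by (subst sum_diff1) (auto simp: R_def)
    also have "(\<Sum>v | v \<in> V \<and> R u v. g (c v)) =
      (if c u = 0 then (\<Sum>v\<in>V. g (c v)) else z * g 0 + k (c u) * g (c u))"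
    proof (cases "c u = 0")
      case True
      then show ?thesis by (simp add: R_def)
    next
      case False
      have "{v \<in> V. R u v} = {v \<in> V. c v = 0} \<union> {v \<in> V. c v = c u}"
        using False by (auto simp: R_def)
      then have "(\<Sum>v | v \<in> V \<and> R u v. g (c v)) =
          (\<Sum>v | v \<in> V \<and> c v = 0. g (c v)) + (\<Sum>v | v \<in> V \<and> c v = c u. g (c v))"
        using False fin by (simp only:) (rule sum.union_disjoint, auto)
      also have "\<dots> = card {v \<in> V. c v = 0} * g 0 + card {v \<in> V. c v = c u} * g (c u)"
        by simp
      finally show ?thesis using False k[of "c u"] lab u z by auto
    qed
    finally show ?thesis .
  qed
  have deg: "real (degree ?G u) = dg (c u)" if "u \<in> V" for u
    using nbr[OF that, of "\<lambda>_. 1"] N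
    by (simp add: degree_rel_graph[OF that sym] dg_def)
  define D where "D = z * dg 0 + p * dg 1 + r * q * dg 2"
  have dg2: "dg (Suc (Suc l)) = dg 2" for l by (simp add: dg_def k_def)
  have k2: "k (Suc (Suc l)) = k 2" for l by (simp add: k_def)
  have k012: "k (Suc 0) = p" "k 2 = q" by (simp_all add: k_def)
  have tot: "(\<Sum>v\<in>V. dg (c v)) = D"
    by (subst total) (simp add: D_def dg2)
  have e2: "2 * real (card (edges ?G)) = D"
  proof -
    have "2 * real (card (edges ?G)) = (\<Sum>u\<in>V. real (degree ?G u))"
      using sum_edges_rel_graph[of V R "\<lambda>_. 1", OF fin sym]
      by (simp add: degree_rel_graph[OF _ sym])
    also have "\<dots> = D" using tot by (simp add: deg)
    finally show ?thesis .
  qed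
  have M1: "real (zagreb1 ?G) = z * (dg 0)\<^sup>2 + p * (dg 1)\<^sup>2 + r * q * (dg 2)\<^sup>2"
    using total[of "\<lambda>l. (dg l)\<^sup>2"] by (simp add: zagreb1_def deg dg2)
  have M2: "2 * real (zagreb2 ?G) = z * (dg 0 * (D - dg 0)) + p * (dg 1 * (z * dg 0 + p * dg 1 - dg 1))
      + r * q * (dg 2 * (z * dg 0 + q * dg 2 - dg 2))"
  proof -
    have "2 * real (zagreb2 ?G) =
      (\<Sum>u\<in>V. \<Sum>v | v \<in> V \<and> v \<noteq> u \<and> R u v. real (\<Prod>w\<in>{u, v}. degree ?G w))"
      unfolding zagreb2_def of_nat_sum by (rule sum_edges_rel_graph[OF fin sym])
    also have "\<dots> = (\<Sum>u\<in>V. \<Sum>v | v \<in> V \<and> v \<noteq> u \<and> R u v. dg (c u) * dg (c v))"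
      by (intro sum.cong HOL.refl) (auto simp: deg)
    also have "\<dots> = (\<Sum>u\<in>V. dg (c u) *
        ((if c u = 0 then D else z * dg 0 + k (c u) * dg (c u)) - dg (c u)))"
      by (intro sum.cong HOL.refl) (simp add: sum_distrib_left[symmetric] nbr tot)
    also have "\<dots> = z * (dg 0 * (D - dg 0)) + p * (dg 1 * (z * dg 0 + p * dg 1 - dg 1))
      + r * q * (dg 2 * (z * dg 0 + q * dg 2 - dg 2))"
      by (subst total[of "\<lambda>l. dg l * ((if l = 0 then D else z * dg 0 + k l * dg l) - dg l)"])
        (simp add: dg2 k2 k012)
    finally show ?thesis .
  qed
  have N2: "N \<ge> 2" using N V2 by linarith
  have nonneg: "p * dg 1 \<ge> 0" "q * dg 2 \<ge> 0" using z1 by (auto simp: dg_def k_def)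
  have "real z * dg 0 > 0" using z1 N2 by (simp add: dg_def)
  moreover have "real r * q * dg 2 \<ge> 0" using nonneg(2) by (simp add: mult.assoc)
  ultimately have D0: "D > 0" using nonneg unfolding D_def of_nat_mult by linarith
  have "N * (2 * real (zagreb2 ?G)) - D * real (zagreb1 ?G) = clique_join_gap z p r q"
    unfolding M1 M2 clique_join_gap_def Let_def D_def
    by (simp add: N_def dg_def k_def algebra_simps)
  then have "real (zagreb1 ?G) / N \<le> (2 * real (zagreb2 ?G)) / D"
    using gap N2 D0 by (simp add: divide_simps mult.commute)
  then show ?thesis
    unfolding hansen_vukicevic_def R_def[symmetric] verts_rel_graph N
    by (simp add: e2[symmetric])
qed

text \<open>With \<open>s = z - 1\<close> the gap factors as \<open>p q\<close> times
\<open>s\<^sup>2 (p + q) + 2 s (p\<^sup>2 - p q + q\<^sup>2) + (p + q) (p - q)\<^sup>2 + 2 p q - p - q\<close>. The middle form is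
\<open>(p - q)\<^sup>2 + p\<^sup>2 + q\<^sup>2\<close>, and the last three terms are \<open>p (q - 1) + q (p - 1)\<close>, so everything is nonnegative
for integers \<open>p, q \<ge> 1\<close>.\<close>

lemma clique_join_gap_two_cliques:
  fixes z p q :: nat
  assumes "z \<ge> 1"
  shows "clique_join_gap z p 1 q \<ge> 0"
proof (cases "p = 0 \<or> q = 0")
  case True
  then show ?thesis
    by (auto simp: clique_join_gap_def Let_def power2_eq_square algebra_simps)
next
  case False
  define s x y where "s = real z - 1" and "x = real p - 1" and "y = real q - 1"
  have pos: "s \<ge> 0" "x \<ge> 0" "y \<ge> 0" using assms False by (auto simp: s_def x_def y_def)
  have zpq: "real z = s + 1" "real p = x + 1" "real q = y + 1" by (auto simp: s_def x_def y_def)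
  have "clique_join_gap z p 1 q = p * q * (s\<^sup>2 * (p + q) + s * ((p - real q)\<^sup>2 + p\<^sup>2 + q\<^sup>2)
      + (p + q) * (p - real q)\<^sup>2 + (p * y + q * x))"
    unfolding clique_join_gap_def Let_def zpq(1) x_def y_def
    by (simp add: power2_eq_square algebra_simps)
  also have "\<dots> \<ge> 0" using pos by (intro mult_nonneg_nonneg add_nonneg_nonneg) auto
  finally show ?thesis .
qed

text \<open>When all clique sizes are multiples of \<open>z\<close>, the gap is \<open>z\<^sup>4 (z a - b)\<close> with \<open>a\<close> and \<open>b\<close> polynomials in the
multiplicities. Written in the excess \<open>u\<close> over the smallest parameter that occurs, both \<open>a\<close> and
\<open>a - b\<close> have nonnegative coefficients, which settles all \<open>z \<ge> 1\<close>. Here there are \<open>k = u + 3\<close> cliques of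
size \<open>z\<close> next to one of size \<open>(k - 1) z\<close>.\<close>

lemma clique_join_gap_many_cliques:
  fixes z u :: real
  assumes "z \<ge> 1" "u \<ge> 0"
  shows "clique_join_gap z ((u + 2) * z) (u + 3) z \<ge> 0"
proof -
  define a where "a = u^5 + 13 * u^4 + 71 * u^3 + 203 * u^2 + 300 * u + 180"
  define b where "b = 2 * u^4 + 24 * u^3 + 106 * u^2 + 204 * u + 144"
  have "clique_join_gap z ((u + 2) * z) (u + 3) z = z^4 * ((z - 1) * a + (a - b))"
    unfolding clique_join_gap_def Let_def a_def b_def
    by (simp add: eval_nat_numeral algebra_simps)
  moreover have "a - b = u^5 + 11 * u^4 + 47 * u^3 + 97 * u^2 + 96 * u + 36"
    by (simp add: a_def b_def)
  moreover have "a \<ge> 0" using assms by (simp add: a_def)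
  ultimately show ?thesis using assms by simp
qed

text \<open>The same expansion for two cliques of size \<open>t z\<close> next to one of size \<open>(2 t - 1) z\<close>, with \<open>t = u + 2\<close>.\<close>

lemma clique_join_gap_three_cliques:
  fixes z u :: real
  assumes "z \<ge> 1" "u \<ge> 0"
  shows "clique_join_gap z ((2 * u + 3) * z) 2 ((u + 2) * z) \<ge> 0"
proof -
  define a where "a = 12 * u^5 + 128 * u^4 + 556 * u^3 + 1216 * u^2 + 1328 * u + 576"
  define b where "b = 8 * u^4 + 96 * u^3 + 368 * u^2 + 576 * u + 320"
  have "clique_join_gap z ((2 * u + 3) * z) 2 ((u + 2) * z) = z^4 * ((z - 1) * a + (a - b))"
    unfolding clique_join_gap_def Let_def a_def b_def
    by (simp add: eval_nat_numeral algebra_simps)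
  moreover have "a - b = 12 * u^5 + 120 * u^4 + 460 * u^3 + 848 * u^2 + 752 * u + 256"
    by (simp add: a_def b_def)
  moreover have "a \<ge> 0" using assms by (simp add: a_def)
  ultimately show ?thesis using assms by simp
qed

section \<open>Super commuting graphs that are joins of cliques\<close>

text \<open>The classes that meet both \<open>A\<close> and its complement matter as well as those that meet the central set
\<open>Z\<close>: a representative in \<open>A\<close> links such a class to \<open>A\<close>, a representative outside links it to the rest.\<close>

definition dominating :: "('a \<times> 'a) set \<Rightarrow> 'a set \<Rightarrow> 'a set \<Rightarrow> 'a set" where
  "dominating B Z A = {g. B `` {g} \<inter> Z \<noteq> {} \<or> B `` {g} \<inter> A \<noteq> {} \<and> B `` {g} - A \<noteq> {}}"

definition clique_label :: "'a set \<Rightarrow> 'a set \<Rightarrow> ('a \<Rightarrow> nat) \<Rightarrow> 'a \<Rightarrow> nat" where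
  "clique_label D A part g = (if g \<in> D then 0 else if g \<in> A then 1 else part g + 2)"

text \<open>Let \<open>A\<close> be a set of pairwise commuting elements such that the elements of \<open>A\<close> outside the central set \<open>Z\<close>
commute with nothing outside \<open>A\<close>. Passing to a super commuting graph can then create edges between
\<open>A\<close> and its complement only at classes that meet \<open>Z\<close> or straddle \<open>A\<close>, and the members of these classes
become adjacent to everything. The remaining part of \<open>A\<close> is a clique, and the remaining elements
outside \<open>A\<close> fall into the cliques named by \<open>part\<close>. By \<open>mixed\<close>, the outside elements form a single
clique as soon as some class straddles \<open>A\<close>; otherwise such a class could miss one of several cliques.\<close>

lemma super_commuting_graph_joined_cliques:
  fixes G (structure) and part :: "'a \<Rightarrow> nat"
  assumes B: "equiv (carrier G) B" and A: "A \<subseteq> carrier G" and Z: "Z \<subseteq> A"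
    and central: "\<And>x y. x \<in> Z \<Longrightarrow> y \<in> carrier G \<Longrightarrow> x \<otimes> y = y \<otimes> x"
    and abelian: "\<And>x y. x \<in> A \<Longrightarrow> y \<in> A \<Longrightarrow> x \<otimes> y = y \<otimes> x"
    and separate: "\<And>x y. x \<in> A - Z \<Longrightarrow> y \<in> carrier G - A \<Longrightarrow> x \<otimes> y \<noteq> y \<otimes> x"
    and part_class: "\<And>x y. x \<in> carrier G - A \<Longrightarrow> y \<in> carrier G - A \<Longrightarrow> (x, y) \<in> B \<Longrightarrow> part x = part y"
    and part_comm: "\<And>x y. x \<in> carrier G - A \<Longrightarrow> y \<in> carrier G - A \<Longrightarrow> x \<otimes> y = y \<otimes> x \<Longrightarrow> part x = part y"
    and part_super: "\<And>x y. x \<in> carrier G - A \<Longrightarrow> y \<in> carrier G - A \<Longrightarrow> part x = part y \<Longrightarrow>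
      \<exists>x'\<in>B `` {x}. \<exists>y'\<in>B `` {y}. x' \<otimes> y' = y' \<otimes> x'"
    and mixed: "\<And>x y w. x \<in> A \<Longrightarrow> y \<in> carrier G - A \<Longrightarrow> w \<in> carrier G - A \<Longrightarrow> (x, y) \<in> B \<Longrightarrow> part w = part y"
  defines "c \<equiv> clique_label (dominating B Z A) A part"
  shows "super_commuting_graph G B = rel_graph (carrier G) (\<lambda>g h. c g = 0 \<or> c h = 0 \<or> c g = c h)"
proof -
  let ?D = "dominating B Z A"
  define adj where "adj g h \<longleftrightarrow> B `` {g} = B `` {h} \<or>
    (\<exists>g'\<in>B `` {g}. \<exists>h'\<in>B `` {h}. g' \<otimes> h' = h' \<otimes> g')" for g h
  have self: "g \<in> B `` {g}" if "g \<in> carrier G" for g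
    using equiv_class_self[OF B that] .
  have class_eq: "B `` {g} = B `` {h}" if "h \<in> B `` {g}" for g h
    using equiv_class_eq[OF B] that by blast
  have in_carrier: "h \<in> carrier G" if "h \<in> B `` {g}" for g h
    using equiv_class_eq_iff[OF B] that by blast
  have adj_sym: "adj g h = adj h g" for g h unfolding adj_def by metis
  have adj_class: "adj g h = adj g' h" if "g' \<in> B `` {g}" for g g' h
    unfolding adj_def class_eq[OF that] ..
  have AA: "adj g h" if "g \<in> A" "h \<in> A" for g h
    unfolding adj_def using abelian[OF that] self that A by blast
  have XX: "adj g h" if "g \<in> carrier G - A" "h \<in> carrier G - A" "part g = part h" for g h
    unfolding adj_def using part_super[OF that] by blast
  have dom: "adj g h" if g: "g \<in> ?D" and h: "h \<in> carrier G" for g h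
  proof -
    consider z where "z \<in> B `` {g}" "z \<in> Z" | x y where "x \<in> B `` {g}" "x \<in> A" "y \<in> B `` {g}" "y \<notin> A"
      using g unfolding dominating_def by blast
    then show ?thesis
    proof cases
      case 1
      then show ?thesis unfolding adj_def using central[OF _ h] self[OF h] by blast
    next
      case 2
      have "(x, y) \<in> B" using class_eq[OF 2(1)] 2(3) by blast
      then have "part h = part y" if "h \<notin> A" using mixed[of x y h] 2 that h in_carrier by blast
      then show ?thesis
        using adj_class[OF 2(1), of h] AA[of x h] adj_class[OF 2(3), of h] XX[of y h]
          2(2,4) h in_carrier[OF 2(3)] by (cases "h \<in> A") auto
    qed
  qed
  have classA: "B `` {g} \<subseteq> A - Z" if "g \<in> A" "g \<notin> ?D" for g
    using that self[of g] A unfolding dominating_def by blast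
  have classX: "B `` {g} \<subseteq> carrier G - A" if "g \<in> carrier G - A" "g \<notin> ?D" for g
    using that self[of g] in_carrier unfolding dominating_def by blast
  have AX: "\<not> adj g h" if "g \<in> A" "h \<in> carrier G - A" "g \<notin> ?D" "h \<notin> ?D" for g h
  proof
    assume "adj g h"
    moreover have "B `` {g} \<noteq> B `` {h}"
      using classA[of g] classX[of h] self[of g] that A by blast
    ultimately show False
      unfolding adj_def using separate classA[of g] classX[of h] that by blast
  qed
  have XX': "part g = part h"
    if gh: "g \<in> carrier G - A" "h \<in> carrier G - A" "g \<notin> ?D" "h \<notin> ?D" "adj g h" for g h
  proof (cases "B `` {g} = B `` {h}")
    case True
    then show ?thesis using part_class[OF gh(1,2)] self[of h] gh by blast
  next
    case False
    then obtain g' h' where *: "g' \<in> B `` {g}" "h' \<in> B `` {h}" "g' \<otimes> h' = h' \<otimes> g'"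
      using gh(5) unfolding adj_def by blast
    have "g' \<in> carrier G - A" "h' \<in> carrier G - A" using * classX gh by blast+
    then have "part g = part g'" "part g' = part h'" "part h = part h'"
      using * part_class gh part_comm by blast+
    then show ?thesis by simp
  qed
  have adj_label: "adj g h \<longleftrightarrow> c g = 0 \<or> c h = 0 \<or> c g = c h" if gh: "g \<in> carrier G" "h \<in> carrier G" for g h
  proof (cases "g \<in> ?D \<or> h \<in> ?D")
    case True
    then show ?thesis
      using dom[of g h] dom[of h g] gh unfolding adj_sym[of h g] c_def clique_label_def by argo
  next
    case False
    then have "adj g h \<longleftrightarrow> g \<in> A \<and> h \<in> A \<or> g \<notin> A \<and> h \<notin> A \<and> part g = part h"
      using gh AA[of g h] AX[of g h] AX[of h g] XX[of g h] XX'[of g h] adj_sym[of g h] by blast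
    then show ?thesis using False by (simp add: c_def clique_label_def)
  qed
  have "rel_graph (carrier G) adj = rel_graph (carrier G) (\<lambda>g h. c g = 0 \<or> c h = 0 \<or> c g = c h)"
    by (rule rel_graph_cong) (rule adj_label)
  then show ?thesis
    unfolding super_commuting_graph_def rel_graph_def adj_def .
qed

section \<open>Normal forms in the presented group\<close>

text \<open>Evaluation of words in the infinite group \<open>\<int> \<rtimes> \<int>\<close> with \<open>(i, j) (k, l) = (i + (-1)\<^sup>j k, j + l)\<close>, where the relation
\<open>b a b\<^sup>-\<^sup>1 = a\<^sup>-\<^sup>1\<close> holds. The coordinates stay unreduced; the two power relations only become
congruences.\<close>

fun word_coords :: "gen_ab letter list \<Rightarrow> int \<times> int" where
  "word_coords [] = (0, 0)"
| "word_coords (Gen gen_a # w) = (case word_coords w of (i, j) \<Rightarrow> (1 + i, j))"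
| "word_coords (Inv gen_a # w) = (case word_coords w of (i, j) \<Rightarrow> (i - 1, j))"
| "word_coords (Gen gen_b # w) = (case word_coords w of (i, j) \<Rightarrow> (- i, j + 1))"
| "word_coords (Inv gen_b # w) = (case word_coords w of (i, j) \<Rightarrow> (- i, j - 1))"

text \<open>The sign in \<open>b\<^sup>j a\<^sup>k = a\<^sup>\<plusminus>\<^sup>k b\<^sup>j\<close>.\<close>

definition twist :: "int \<Rightarrow> int \<Rightarrow> int" where
  "twist j k = (if even j then k else - k)"

lemma word_coords_append:
  "word_coords (u @ v) = (fst (word_coords u) + twist (snd (word_coords u)) (fst (word_coords v)),
     snd (word_coords u) + snd (word_coords v))"
  by (induction u rule: word_coords.induct) (auto simp: twist_def split: prod.splits)

lemma word_coords_replicate: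
  "word_coords (replicate k (Gen gen_a)) = (int k, 0)"
  "word_coords (replicate k (Inv gen_a)) = (- int k, 0)"
  "word_coords (replicate k (Gen gen_b)) = (0, int k)"
  "word_coords (replicate k (Inv gen_b)) = (0, - int k)"
  by (induction k) auto

lemma word_coords_surj: "\<exists>w. word_coords w = (i, j)"
proof -
  have a: "\<exists>w. word_coords w = (i, 0)"
    by (cases i rule: int_cases2) (metis word_coords_replicate)+
  have b: "\<exists>w. word_coords w = (0, j)"
    by (cases j rule: int_cases2) (metis word_coords_replicate)+
  obtain u v where "word_coords u = (i, 0)" "word_coords v = (0, j)" using a b by blast
  then have "word_coords (u @ v) = (i, j)" by (simp add: word_coords_append twist_def)
  then show ?thesis ..
qed

definition M_relations :: "nat \<Rightarrow> nat \<Rightarrow> (gen_ab letter list \<times> gen_ab letter list) set" where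
  "M_relations m n = {(replicate m (Gen gen_a), []),
      (replicate (2 * n) (Gen gen_b), []),
      ([Gen gen_b, Gen gen_a, Inv gen_b], [Inv gen_a])}"

text \<open>This bounds the presented group from below: words with incongruent coordinates are different
elements. The relation \<open>b\<^sup>2\<^sup>n = 1\<close> must have even length here, since a congruence modulo an odd number
would not determine the sign in the product rule.\<close>

lemma word_eq_coords:
  assumes "word_eq (M_relations m n) u v"
  shows "int m dvd fst (word_coords u) - fst (word_coords v) \<and>
    int (2 * n) dvd snd (word_coords u) - snd (word_coords v)"
  using assms
proof induction
  case (refl u)
  then show ?case by simp
next
  case (sym u v)
  then show ?case by (simp add: dvd_diff_commute)
next
  case (trans u v w)
  then show ?case
    using dvd_add[of "int m" "fst (word_coords u) - fst (word_coords v)" "fst (word_coords v) - fst (word_coords w)"]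
      dvd_add[of "int (2 * n)" "snd (word_coords u) - snd (word_coords v)" "snd (word_coords v) - snd (word_coords w)"]
    by simp
next
  case (cong u v xs ys)
  have "even (snd (word_coords u) - snd (word_coords v))"
    using cong.IH by (metis dvd_trans dvd_triv_left of_nat_mult of_nat_numeral)
  moreover have "int m dvd (a + b) - (a + b')" "int m dvd (a - b) - (a - b')" "int m dvd (b + a) - (b' + a)"
    if "int m dvd b - b'" for a b b'
    using that dvd_diff_commute[of "int m" b b'] by (simp_all add: algebra_simps)
  ultimately show ?case
    using cong.IH dvd_diff_commute[of "int m" "fst (word_coords u)" "fst (word_coords v)"]
    by (auto simp: word_coords_append twist_def)
next
  case (cancel x)
  then show ?case
    by (cases x; cases "case x of Gen y \<Rightarrow> y | Inv y \<Rightarrow> y") auto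
next
  case (rel u v)
  then show ?case by (auto simp: M_relations_def word_coords_replicate simp del: replicate.simps)
qed

lemma (in group) conj_int_pow:
  assumes "x \<in> carrier G" "y \<in> carrier G"
  shows "y \<otimes> x [^] (i :: int) \<otimes> inv y = (y \<otimes> x \<otimes> inv y) [^] i"
proof -
  have "inv y \<otimes> (y \<otimes> w) = w" if "w \<in> carrier G" for w
    using assms that by (simp add: m_assoc[symmetric])
  then have "(\<lambda>x. y \<otimes> x \<otimes> inv y) \<in> hom G G"
    using assms by (simp add: hom_def m_assoc)
  from hom_int_pow[OF this assms(1)] show ?thesis by (simp add: is_group)
qed

text \<open>All that is used about the group: \<open>E i j\<close> stands for \<open>a\<^sup>i b\<^sup>j\<close> with integer exponents, so that products need
no reduction and only equality of elements involves congruences.\<close>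

locale klein_coordinates = group G for G (structure) +
  fixes m n :: nat and E :: "int \<Rightarrow> int \<Rightarrow> 'a"
  assumes carrier_E: "carrier G = {E i j | i j. True}"
    and E_mult: "E i j \<otimes> E k l = E (i + twist j k) (j + l)"
    and E_eq_iff: "E i j = E k l \<longleftrightarrow> int m dvd i - k \<and> int (2 * n) dvd j - l"

text \<open>Prefixing one letter changes the normal form \<open>a\<^sup>i b\<^sup>j\<close> exactly as it changes the coordinates, so the class
of every word is determined by its coordinates; with the lower bound above this identifies the
presented group.\<close>

lemma klein_coordinates_M_group: "\<exists>E. klein_coordinates (M_group m n) m n E"
proof -
  define R where "R = M_relations m n"
  have M: "M_group m n = presented_group R"
    by (simp add: M_group_def R_def M_relations_def)
  interpret group "presented_group R" by (rule group_presented_group)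
  let ?G = "presented_group R"
  define cl where "cl u = word_rel R `` {u}" for u
  have car: "carrier ?G = range cl"
    by (auto simp: presented_group_def quotient_def cl_def)
  have cl_carrier [simp, intro]: "cl u \<in> carrier ?G" for u by (simp add: car)
  have cl_mult: "cl (u @ v) = cl u \<otimes>\<^bsub>?G\<^esub> cl v" for u v
    by (simp add: cl_def presented_group_mult)
  have cl_one: "cl [] = \<one>\<^bsub>?G\<^esub>" by (simp add: cl_def presented_group_def)
  have cl_eq: "cl u = cl v \<longleftrightarrow> word_eq R u v" for u v
    unfolding cl_def using eq_equiv_class_iff[OF equiv_word_rel] by (simp add: word_rel_def)
  have cl_inv: "cl [Inv x] = inv\<^bsub>?G\<^esub> cl [Gen x]" for x
  proof -
    have "cl [Inv x] \<otimes>\<^bsub>?G\<^esub> cl [Gen x] = \<one>\<^bsub>?G\<^esub>"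
      using word_eq.cancel[of R "Inv x"] by (simp add: cl_mult[symmetric] cl_one[symmetric] cl_eq)
    then show ?thesis by (simp add: inv_equality)
  qed
  define a where "a = cl [Gen gen_a]"
  define b where "b = cl [Gen gen_b]"
  have ab [simp]: "a \<in> carrier ?G" "b \<in> carrier ?G" by (simp_all add: a_def b_def)
  have pow: "cl (replicate k (Gen x)) = cl [Gen x] [^]\<^bsub>?G\<^esub> k" for k x
  proof (induction k)
    case (Suc k)
    have "cl (replicate (Suc k) (Gen x)) = cl (replicate k (Gen x) @ [Gen x])"
      by (simp add: replicate_append_same)
    then show ?case using Suc by (simp only: cl_mult nat_pow_Suc)
  qed (simp add: cl_one)
  have am: "a [^]\<^bsub>?G\<^esub> m = \<one>\<^bsub>?G\<^esub>" and bn: "b [^]\<^bsub>?G\<^esub> (2 * n) = \<one>\<^bsub>?G\<^esub>"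
    unfolding a_def b_def pow[symmetric] cl_one[symmetric] cl_eq
    by (rule word_eq.rel, simp add: R_def M_relations_def)+
  have bab: "b \<otimes>\<^bsub>?G\<^esub> a \<otimes>\<^bsub>?G\<^esub> inv\<^bsub>?G\<^esub> b = inv\<^bsub>?G\<^esub> a"
  proof -
    have "cl ([Gen gen_b] @ [Gen gen_a] @ [Inv gen_b]) = cl [Inv gen_a]"
      unfolding cl_eq by (rule word_eq.rel) (simp add: R_def M_relations_def)
    then show ?thesis
      unfolding cl_mult cl_inv a_def[symmetric] b_def[symmetric] by (simp add: m_assoc)
  qed
  have ba: "b \<otimes>\<^bsub>?G\<^esub> a [^]\<^bsub>?G\<^esub> i = a [^]\<^bsub>?G\<^esub> (- i) \<otimes>\<^bsub>?G\<^esub> b" for i :: int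
  proof -
    have "b \<otimes>\<^bsub>?G\<^esub> a [^]\<^bsub>?G\<^esub> i \<otimes>\<^bsub>?G\<^esub> inv\<^bsub>?G\<^esub> b = a [^]\<^bsub>?G\<^esub> (- i)"
      by (simp add: conj_int_pow bab int_pow_inv int_pow_neg)
    then show ?thesis by (metis ab inv_solve_right int_pow_closed m_closed)
  qed
  have Ba: "inv\<^bsub>?G\<^esub> b \<otimes>\<^bsub>?G\<^esub> a [^]\<^bsub>?G\<^esub> i = a [^]\<^bsub>?G\<^esub> (- i) \<otimes>\<^bsub>?G\<^esub> inv\<^bsub>?G\<^esub> b" for i :: int
  proof -
    have "a [^]\<^bsub>?G\<^esub> i = b \<otimes>\<^bsub>?G\<^esub> (a [^]\<^bsub>?G\<^esub> (- i) \<otimes>\<^bsub>?G\<^esub> inv\<^bsub>?G\<^esub> b)"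
      using ba[of "- i"] by (simp add: m_assoc[symmetric]) (simp add: m_assoc)
    then show ?thesis by (metis ab inv_solve_left int_pow_closed m_closed inv_closed)
  qed
  define E where "E i j = a [^]\<^bsub>?G\<^esub> (i :: int) \<otimes>\<^bsub>?G\<^esub> b [^]\<^bsub>?G\<^esub> (j :: int)" for i j
  have E_carrier [simp]: "E i j \<in> carrier ?G" for i j by (simp add: E_def)
  have step: "a \<otimes>\<^bsub>?G\<^esub> E i j = E (1 + i) j" "inv\<^bsub>?G\<^esub> a \<otimes>\<^bsub>?G\<^esub> E i j = E (i - 1) j"
    "b \<otimes>\<^bsub>?G\<^esub> E i j = E (- i) (j + 1)" "inv\<^bsub>?G\<^esub> b \<otimes>\<^bsub>?G\<^esub> E i j = E (- i) (j - 1)" for i j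
  proof -
    have 1: "x [^]\<^bsub>?G\<^esub> (1 + k) = x \<otimes>\<^bsub>?G\<^esub> x [^]\<^bsub>?G\<^esub> k"
      "x [^]\<^bsub>?G\<^esub> (k - 1) = inv\<^bsub>?G\<^esub> x \<otimes>\<^bsub>?G\<^esub> x [^]\<^bsub>?G\<^esub> k" if "x \<in> carrier ?G" for x and k :: int
      using int_pow_mult[OF that, of 1 k] int_pow_mult[OF that, of "- 1" k] that
      by (simp_all add: int_pow_neg)
    show "a \<otimes>\<^bsub>?G\<^esub> E i j = E (1 + i) j" "inv\<^bsub>?G\<^esub> a \<otimes>\<^bsub>?G\<^esub> E i j = E (i - 1) j"
      by (simp_all add: E_def 1 m_assoc)
    show "b \<otimes>\<^bsub>?G\<^esub> E i j = E (- i) (j + 1)"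
      unfolding E_def add.commute[of j] 1(1)[OF ab(2)] using ba[of i]
      by (simp add: m_assoc[symmetric])
    show "inv\<^bsub>?G\<^esub> b \<otimes>\<^bsub>?G\<^esub> E i j = E (- i) (j - 1)"
      unfolding E_def 1(2)[OF ab(2)] using Ba[of i]
      by (simp add: m_assoc[symmetric])
  qed
  have cl_E: "cl u = E (fst (word_coords u)) (snd (word_coords u))" for u
  proof (induction u)
    case Nil
    then show ?case by (simp add: cl_one E_def)
  next
    case (Cons x u)
    have "cl (x # u) = cl [x] \<otimes>\<^bsub>?G\<^esub> cl u" using cl_mult[of "[x]" u] by simp
    moreover obtain i j where ij: "word_coords u = (i, j)" by fastforce
    ultimately have x: "cl (x # u) = cl [x] \<otimes>\<^bsub>?G\<^esub> E i j" using Cons.IH by simp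
    show ?case
    proof (cases x)
      case (Gen y)
      then show ?thesis unfolding x
        by (cases y) (simp_all add: step a_def[symmetric] b_def[symmetric] ij)
    next
      case (Inv y)
      then show ?thesis unfolding x
        by (cases y) (simp_all add: step a_def[symmetric] b_def[symmetric] ij cl_inv)
    qed
  qed
  have E_cl: "\<exists>w. word_coords w = (i, j) \<and> E i j = cl w" for i j
    using word_coords_surj[of i j] cl_E by fastforce
  have "klein_coordinates ?G m n E"
  proof
    show "carrier ?G = {E i j | i j. True}"
    proof
      show "carrier ?G \<subseteq> {E i j | i j. True}" unfolding car using cl_E by blast
      show "{E i j | i j. True} \<subseteq> carrier ?G" by auto
    qed
    fix i j k l
    obtain u v where uv: "word_coords u = (i, j)" "E i j = cl u" "word_coords v = (k, l)" "E k l = cl v"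
      using E_cl by metis
    show "E i j \<otimes>\<^bsub>?G\<^esub> E k l = E (i + twist j k) (j + l)"
      unfolding uv(2,4) cl_mult[symmetric] by (simp add: cl_E uv(1,3) word_coords_append)
    show "E i j = E k l \<longleftrightarrow> int m dvd i - k \<and> int (2 * n) dvd j - l"
    proof
      assume "E i j = E k l"
      then have "word_eq R u v" by (simp add: uv cl_eq)
      then show "int m dvd i - k \<and> int (2 * n) dvd j - l"
        using word_eq_coords[of m n u v] by (simp add: uv R_def)
    next
      assume dvd: "int m dvd i - k \<and> int (2 * n) dvd j - l"
      have "int (ord a) dvd int m" "int (ord b) dvd int (2 * n)"
        using am bn by (simp_all only: pow_eq_id ab int_dvd_int_iff)
      then have "a [^]\<^bsub>?G\<^esub> i = a [^]\<^bsub>?G\<^esub> k" "b [^]\<^bsub>?G\<^esub> j = b [^]\<^bsub>?G\<^esub> l"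
        using dvd by (simp_all only: int_pow_eq ab) (metis dvd_trans dvd_diff_commute)+
      then show "E i j = E k l" by (simp add: E_def)
    qed
  qed
  then show ?thesis unfolding M by blast
qed

section \<open>Commutation, conjugacy and orders in coordinates\<close>

lemma even_if_double_dvd: "int (2 * n) dvd x \<Longrightarrow> even x"
  by (rule dvd_trans[of 2 "int (2 * n)"]) simp_all

context klein_coordinates
begin

lemma E_closed [simp, intro]: "E i j \<in> carrier G"
  using carrier_E by blast

lemma carrier_cases:
  assumes "x \<in> carrier G"
  obtains i j where "x = E i j"
  using assms carrier_E by blast

text \<open>The subgroup generated by \<open>a\<close> and \<open>b\<^sup>2\<close>.\<close>

definition abelian_half where "abelian_half = {E i j | i j. even j}"

text \<open>The order of \<open>a\<close> modulo the centre: \<open>m\<close> for odd \<open>m\<close> and \<open>m / 2\<close> for even \<open>m\<close>.\<close>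

definition central_period where "central_period = m div gcd m 2"

definition centre where "centre = {E i j | i j. even j \<and> int central_period dvd i}"

lemma central_period_dvd: "central_period dvd m"
  unfolding central_period_def by (metis dvd_div_mult_self dvd_triv_left gcd_dvd1)

lemma dvd_double_iff_central_period_dvd: "int m dvd 2 * x \<longleftrightarrow> int central_period dvd x"
proof (cases "even m")
  case True
  then obtain t where t: "m = 2 * t" by blast
  have "gcd m 2 = 2" using True by (simp add: gcd_nat.absorb2)
  then have "central_period = t" using t unfolding central_period_def by simp
  then show ?thesis using t by simp
next
  case False
  then have "coprime (int m) 2" by simp
  moreover have "central_period = m"
    using False by (simp add: central_period_def coprime_iff_gcd_eq_1[symmetric])
  ultimately show ?thesis by (simp add: coprime_dvd_mult_right_iff)
qed

lemma parity: "E i j = E k l \<Longrightarrow> even j \<longleftrightarrow> even l"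
  unfolding E_eq_iff using even_if_double_dvd[of n "j - l"] by simp

lemma E_in_abelian_half [simp]: "E i j \<in> abelian_half \<longleftrightarrow> even j"
  unfolding abelian_half_def using parity by blast

lemma E_in_centre [simp]: "E i j \<in> centre \<longleftrightarrow> even j \<and> int central_period dvd i"
proof
  assume "E i j \<in> centre"
  then obtain k l where kl: "E i j = E k l" "even l" "int central_period dvd k" unfolding centre_def by blast
  then have "int central_period dvd i - k" using central_period_dvd unfolding E_eq_iff by (meson dvd_trans int_dvd_int_iff)
  then have "int central_period dvd i" using kl(3) by (metis diff_add_cancel dvd_add)
  then show "even j \<and> int central_period dvd i" using kl parity by blast
qed (auto simp: centre_def)

lemma abelian_half_subset: "abelian_half \<subseteq> carrier G" by (auto simp: abelian_half_def)

lemma centre_subset: "centre \<subseteq> abelian_half" by (auto simp: abelian_half_def centre_def)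

text \<open>Commutators of \<open>a\<^sup>i b\<^sup>j\<close> and \<open>a\<^sup>k b\<^sup>l\<close> are powers \<open>a\<^sup>2\<^sup>x\<close> with \<open>x\<close> one of \<open>0\<close>, \<open>\<plusminus>i\<close>, \<open>\<plusminus>k\<close>, \<open>\<plusminus>(i - k)\<close>, and such a power is
trivial precisely when the central period divides \<open>x\<close>.\<close>

lemma commute_iff:
  "E i j \<otimes> E k l = E k l \<otimes> E i j \<longleftrightarrow>
    (if even j then even l \<or> int central_period dvd i else if even l then int central_period dvd k else int central_period dvd i - k)"
proof -
  have "E i j \<otimes> E k l = E k l \<otimes> E i j \<longleftrightarrow> int m dvd (i + twist j k) - (k + twist l i)"
    by (simp add: E_mult E_eq_iff)
  also have "(i + twist j k) - (k + twist l i) =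
    (if even j then if even l then 0 else 2 * i else if even l then - (2 * k) else 2 * (i - k))"
    by (simp add: twist_def)
  finally show ?thesis by (simp add: dvd_double_iff_central_period_dvd del: right_diff_distrib_numeral)
qed

text \<open>The single count behind the sizes of the centre, of the abelian half, and of the cliques outside it.\<close>

lemma card_coords:
  fixes e :: nat and c s :: int
  assumes e: "e dvd m" and m: "m \<ge> 1" and n: "n \<ge> 1"
  shows "card {E i j | i j. int e dvd i - c \<and> even (j - s)} = (m div e) * n"
proof -
  define h where "h = (\<lambda>(x, y). E (c + int e * int x) (s + 2 * int y))"
  have e0: "e \<ge> 1" and me: "int m = int e * int (m div e)"
    using e m by (auto simp: Suc_le_eq simp flip: of_nat_mult intro: gr0I)
  have dvd_small: "x = y" if "int d dvd int x - int y" "x < d" "y < d" for d x y :: nat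
    using that by (metis mod_eq_dvd_iff mod_less of_nat_eq_iff zmod_int)
  have inj: "inj_on h ({..<m div e} \<times> {..<n})"
  proof (rule inj_onI, clarsimp simp: h_def E_eq_iff)
    fix x y x' y'
    assume *: "x < m div e" "y < n" "x' < m div e" "y' < n"
      "int m dvd int e * int x - int e * int x'" "2 * int n dvd 2 * int y - 2 * int y'"
    have "int (m div e) dvd int x - int x'" "int n dvd int y - int y'"
      using *(5,6) e0 unfolding me right_diff_distrib[symmetric] dvd_mult_cancel_left by simp_all
    then show "x = x' \<and> y = y'" using dvd_small * by blast
  qed
  have "h ` ({..<m div e} \<times> {..<n}) = {E i j | i j. int e dvd i - c \<and> even (j - s)}" (is "?L = ?S")
  proof
    show "?L \<subseteq> ?S" unfolding h_def by fastforce
    show "?S \<subseteq> ?L"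
    proof
      fix g assume "g \<in> ?S"
      then obtain i j where ij: "g = E i j" "int e dvd i - c" "even (j - s)" by blast
      then obtain x y where "i - c = int e * x" "j - s = 2 * y" by (metis dvdE)
      then have x: "i = c + int e * x" and y: "j = s + 2 * y" by simp_all
      define x' y' where "x' = nat (x mod int (m div e))" and "y' = nat (y mod int n)"
      have q: "m div e > 0" using me m by (intro gr0I) simp
      have x': "int x' = x mod int (m div e)" "x' < m div e"
        using q unfolding x'_def by (simp_all add: nat_less_iff)
      have y': "int y' = y mod int n" "y' < n"
        using n unfolding y'_def by (simp_all add: nat_less_iff)
      have "i - (c + int e * int x') = int m * (x div int (m div e))"
        unfolding x x'(1) minus_mult_div_eq_mod[symmetric] by (subst me) (simp add: algebra_simps)
      moreover have "j - (s + 2 * int y') = int (2 * n) * (y div int n)"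
        unfolding y y'(1) minus_mult_div_eq_mod[symmetric] by (simp add: algebra_simps)
      ultimately have "g = h (x', y')" unfolding ij(1) h_def by (simp add: E_eq_iff)
      then show "g \<in> ?L" using x' y' by blast
    qed
  qed
  then show ?thesis using card_image[OF inj] by simp
qed

text \<open>The residue modulo \<open>e\<close> of the exponent of \<open>a\<close>. The exponent is only determined modulo \<open>m\<close>, so the residue
is meaningful for divisors \<open>e\<close> of \<open>m\<close>.\<close>

definition block :: "nat \<Rightarrow> 'a \<Rightarrow> nat" where
  "block e g = nat ((SOME i. \<exists>j. g = E i j) mod int e)"

lemma block_E:
  assumes "e dvd m"
  shows "block e (E i j) = nat (i mod int e)"
proof -
  obtain j' where j': "E i j = E (SOME k. \<exists>l. E i j = E k l) j'"
    using someI_ex[of "\<lambda>k. \<exists>l. E i j = E k l"] by blast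
  then have "int e dvd i - (SOME k. \<exists>l. E i j = E k l)"
    using assms unfolding E_eq_iff[of i j "SOME k. \<exists>l. E i j = E k l"] by (meson dvd_trans int_dvd_int_iff)
  then show ?thesis unfolding block_def by (simp add: mod_eq_dvd_iff[symmetric])
qed

lemma block_eq_iff:
  assumes "e dvd m" "e \<ge> 1"
  shows "block e (E i j) = block e (E k l) \<longleftrightarrow> int e dvd i - k"
  using assms by (auto simp: block_E mod_eq_dvd_iff[symmetric] nat_eq_iff2)

lemma outside_cases:
  assumes "x \<in> carrier G - abelian_half"
  obtains i j where "x = E i j" "odd j"
  using assms by (metis DiffE E_in_abelian_half carrier_cases)

lemma centre_commutes: "x \<in> centre \<Longrightarrow> y \<in> carrier G \<Longrightarrow> x \<otimes> y = y \<otimes> x"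
  by (elim carrier_cases) (auto simp: centre_def commute_iff)

lemma abelian_half_commutes: "x \<in> abelian_half \<Longrightarrow> y \<in> abelian_half \<Longrightarrow> x \<otimes> y = y \<otimes> x"
  by (auto simp: abelian_half_def commute_iff)

lemma noncentral_not_commute:
  assumes "x \<in> abelian_half - centre" "y \<in> carrier G - abelian_half"
  shows "x \<otimes> y \<noteq> y \<otimes> x"
proof -
  obtain i j where x: "x = E i j" "even j" using assms(1) by (auto simp: abelian_half_def)
  obtain k l where y: "y = E k l" "odd l" using assms(2) by (rule outside_cases)
  show ?thesis using assms(1) x y by (simp add: commute_iff)
qed

lemma card_abelian_half:
  assumes "m \<ge> 1" "n \<ge> 1"
  shows "card abelian_half = m * n"
  using card_coords[of 1 0 0] assms by (simp add: abelian_half_def)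

lemma card_centre:
  assumes "m \<ge> 1" "n \<ge> 1"
  shows "card centre = (m div central_period) * n"
proof -
  have "centre = {E i j | i j. int central_period dvd i - 0 \<and> even (j - 0)}" by (auto simp: centre_def)
  then show ?thesis using card_coords[OF central_period_dvd assms, of 0 0] by simp
qed

lemma finite_carrier:
  assumes "m \<ge> 1" "n \<ge> 1"
  shows "finite (carrier G)"
proof -
  have "carrier G = abelian_half \<union> {E i j | i j. int 1 dvd i - 0 \<and> even (j - 1)}"
    unfolding carrier_E abelian_half_def by auto
  moreover have "card {E i j | i j. int 1 dvd i - 0 \<and> even (j - 1)} > 0"
    using card_coords[of 1 0 1] assms by simp
  moreover have "card abelian_half > 0" using card_abelian_half assms by simp
  ultimately show ?thesis by (simp only: card_gt_0_iff finite_Un)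
qed

text \<open>If the elements outside the abelian half form one clique, the graph consists of two cliques
overlapping in the dominating vertices. The inequality then holds whatever the sizes are.\<close>

lemma hansen_vukicevic_one_block:
  assumes mn: "m \<ge> 2" "n \<ge> 1" and B: "equiv (carrier G) B"
    and super: "\<And>x y. x \<in> carrier G - abelian_half \<Longrightarrow> y \<in> carrier G - abelian_half \<Longrightarrow>
      \<exists>x'\<in>B `` {x}. \<exists>y'\<in>B `` {y}. x' \<otimes> y' = y' \<otimes> x'"
  shows "hansen_vukicevic (super_commuting_graph G B)"
proof -
  define c where "c = clique_label (dominating B centre abelian_half) abelian_half (\<lambda>_. 0)"
  have graph: "super_commuting_graph G B = rel_graph (carrier G) (\<lambda>g h. c g = 0 \<or> c h = 0 \<or> c g = c h)"
    unfolding c_def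
    by (rule super_commuting_graph_joined_cliques[OF B abelian_half_subset centre_subset centre_commutes abelian_half_commutes noncentral_not_commute _ _ super])
      simp_all
  have fin: "finite (carrier G)" using finite_carrier mn by simp
  have "E 0 0 \<in> B `` {E 0 0} \<inter> centre" using equiv_class_self[OF B, of "E 0 0"] by simp
  then have "c (E 0 0) = 0" by (auto simp: c_def clique_label_def dominating_def)
  then have "card {v \<in> carrier G. c v = 0} > 0" using fin by (auto simp: card_gt_0_iff)
  moreover have "card (carrier G) \<ge> 2"
  proof -
    have "2 * 1 \<le> m * n" using mn by (intro mult_le_mono) auto
    then show ?thesis using card_mono[OF fin abelian_half_subset] card_abelian_half mn by simp
  qed
  ultimately show ?thesis
    unfolding graph
    by (intro hansen_vukicevic_joined_cliques[where r = 1 and z = "card {v \<in> carrier G. c v = 0}"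
          and p = "card {v \<in> carrier G. c v = 1}" and q = "card {v \<in> carrier G. c v = 2}"])
      (use fin clique_join_gap_two_cliques in \<open>auto simp: c_def clique_label_def numeral_2_eq_2\<close>)
qed

text \<open>If the relation respects both the abelian half and the centre, the dominating vertices are exactly
the central elements and all clique sizes are known.\<close>

lemma hansen_vukicevic_equal_blocks:
  assumes mn: "m \<ge> 2" "n \<ge> 1" and B: "equiv (carrier G) B"
    and B_A: "\<And>x y. (x, y) \<in> B \<Longrightarrow> x \<in> abelian_half \<Longrightarrow> y \<in> abelian_half"
    and B_Z: "\<And>x y. (x, y) \<in> B \<Longrightarrow> y \<in> centre \<Longrightarrow> x \<in> centre"
    and e: "e dvd central_period" "e \<ge> 1"
    and B_block: "\<And>x y. x \<in> carrier G - abelian_half \<Longrightarrow> y \<in> carrier G - abelian_half \<Longrightarrow> (x, y) \<in> B \<Longrightarrow> block e x = block e y"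
    and super: "\<And>x y. x \<in> carrier G - abelian_half \<Longrightarrow> y \<in> carrier G - abelian_half \<Longrightarrow> block e x = block e y \<Longrightarrow>
      \<exists>x'\<in>B `` {x}. \<exists>y'\<in>B `` {y}. x' \<otimes> y' = y' \<otimes> x'"
    and gap: "clique_join_gap (real (m div central_period * n)) (real (m * n - m div central_period * n)) (real e) (real (m div e * n)) \<ge> 0"
  shows "hansen_vukicevic (super_commuting_graph G B)"
proof -
  define c where "c = clique_label (dominating B centre abelian_half) abelian_half (block e)"
  have em: "e dvd m" using e(1) central_period_dvd by (rule dvd_trans)
  have block_comm: "block e x = block e y"
    if xy: "x \<in> carrier G - abelian_half" "y \<in> carrier G - abelian_half" "x \<otimes> y = y \<otimes> x" for x y
  proof -
    obtain i j k l where "x = E i j" "odd j" "y = E k l" "odd l"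
      using xy(1,2) by (metis outside_cases)
    then show ?thesis
      using xy(3) e by (auto simp: commute_iff block_eq_iff[OF em e(2)] intro: dvd_trans)
  qed
  have graph: "super_commuting_graph G B = rel_graph (carrier G) (\<lambda>g h. c g = 0 \<or> c h = 0 \<or> c g = c h)"
    unfolding c_def
    by (rule super_commuting_graph_joined_cliques[OF B abelian_half_subset centre_subset centre_commutes abelian_half_commutes noncentral_not_commute B_block block_comm super])
      (use B_A in blast)+
  have fin: "finite (carrier G)" using finite_carrier mn by simp
  have D: "g \<in> dominating B centre abelian_half \<longleftrightarrow> g \<in> centre" if g: "g \<in> carrier G" for g
  proof
    assume "g \<in> dominating B centre abelian_half"
    then consider z where "(g, z) \<in> B" "z \<in> centre" | x y where "(g, x) \<in> B" "x \<in> abelian_half" "(g, y) \<in> B" "y \<notin> abelian_half"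
      unfolding dominating_def by blast
    then show "g \<in> centre"
    proof cases
      case 2
      have "(x, y) \<in> B" using 2(1,3) B by (meson equivE symD transD)
      then show ?thesis using B_A 2 by blast
    qed (use B_Z in blast)
  next
    assume "g \<in> centre"
    then show "g \<in> dominating B centre abelian_half"
      unfolding dominating_def using equiv_class_self[OF B g] by blast
  qed
  have c0: "{v \<in> carrier G. c v = 0} = centre"
    using D abelian_half_subset centre_subset by (auto simp: c_def clique_label_def)
  have c1: "{v \<in> carrier G. c v = 1} = abelian_half - centre"
    using D abelian_half_subset by (auto simp: c_def clique_label_def)
  have c2: "{v \<in> carrier G. c v = l + 2} = {E i j | i j. int e dvd i - int l \<and> even (j - 1)}"
    if l: "l < e" for l
  proof -
    have block: "block e (E i j) = l \<longleftrightarrow> int e dvd i - int l" for i j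
      using block_eq_iff[OF em e(2), of i j "int l" 0] l by (simp add: block_E[OF em])
    have "{v \<in> carrier G. c v = l + 2} = {v \<in> carrier G - abelian_half. block e v = l}"
      using D centre_subset by (auto simp: c_def clique_label_def)
    also have "\<dots> = {E i j | i j. int e dvd i - int l \<and> even (j - 1)}"
    proof (intro Set.set_eqI iffI)
      fix v assume v: "v \<in> {v \<in> carrier G - abelian_half. block e v = l}"
      then obtain i j where ij: "v = E i j" "odd j" using outside_cases by blast
      then show "v \<in> {E i j | i j. int e dvd i - int l \<and> even (j - 1)}" using v block by auto
    qed (use block in auto)
    finally show ?thesis .
  qed
  have le: "c ` carrier G \<subseteq> {..<e + 2}"
  proof -
    have "block e v < e" for v using e(2) by (simp add: block_def nat_less_iff)
    then show ?thesis by (auto simp: c_def clique_label_def)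
  qed
  have finA: "finite abelian_half" using fin abelian_half_subset by (rule rev_finite_subset)
  have m1: "m \<ge> 1" using mn by simp
  have c1': "card {v \<in> carrier G. c v = 1} = m * n - m div central_period * n"
    unfolding c1 using card_Diff_subset[OF finite_subset[OF centre_subset finA] centre_subset]
      card_abelian_half[OF m1 mn(2)] card_centre[OF m1 mn(2)] by simp
  have c2': "card {v \<in> carrier G. c v = l + 2} = m div e * n" if "l < e" for l
    unfolding c2[OF that] by (rule card_coords[OF em m1 mn(2)])
  have "E 0 0 \<in> centre" by simp
  then have "centre \<noteq> {}" by blast
  then have "card centre > 0" using finite_subset[OF centre_subset finA] by (simp add: card_gt_0_iff)
  then have z1: "1 \<le> m div central_period * n" using card_centre[OF m1 mn(2)] by simp
  have V2: "card (carrier G) \<ge> 2"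
  proof -
    have "2 * 1 \<le> m * n" using mn by (intro mult_le_mono) auto
    then show ?thesis using card_mono[OF fin abelian_half_subset] card_abelian_half[OF m1 mn(2)] by simp
  qed
  have c0': "card {v \<in> carrier G. c v = 0} = m div central_period * n"
    unfolding c0 by (rule card_centre[OF m1 mn(2)])
  show ?thesis
    unfolding graph by (rule hansen_vukicevic_joined_cliques[OF fin le c0' c1' c2' z1 V2 gap])
qed

lemma central_period_ge_3:
  assumes "m \<ge> 3" "m \<noteq> 4"
  shows "central_period \<ge> 3"
proof (cases "even m")
  case True
  have "gcd m 2 = 2" using True by (simp add: gcd_nat.absorb2)
  then show ?thesis using assms True unfolding central_period_def by presburger
next
  case False
  then show ?thesis using assms by (simp add: central_period_def coprime_iff_gcd_eq_1[symmetric])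
qed

lemma centre_size:
  assumes "m \<ge> 1" "n \<ge> 1"
  shows "m * n = central_period * (m div central_period * n)" "m div central_period * n \<ge> 1"
proof -
  show "m * n = central_period * (m div central_period * n)" using central_period_dvd by (simp add: mult.assoc[symmetric])
  then show "m div central_period * n \<ge> 1" using assms by (metis less_one linorder_not_le mult_0_right mult_is_0)
qed

text \<open>Two elements outside the abelian half commute iff they lie in the same coset of the centre, so the cliques there
have the size of the centre.\<close>

lemma hansen_vukicevic_ESCom:
  assumes "m \<ge> 3" "m \<noteq> 4" "n \<ge> 1"
  shows "hansen_vukicevic (ESCom G)"
  unfolding ESCom_def
proof (rule hansen_vukicevic_equal_blocks[where e = central_period])
  have K3: "central_period \<ge> 3" using central_period_ge_3 assms by simp
  show "central_period \<ge> 1" using K3 by simp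
  show "equiv (carrier G) (Id_on (carrier G))" by (rule equivI) (auto simp: refl_on_def sym_def trans_def)
  define z where "z = m div central_period * n"
  have z: "m * n = central_period * z" "z \<ge> 1" using centre_size assms by (simp_all add: z_def)
  obtain u where u: "central_period = u + 3" using K3 by (metis add.commute le_iff_add)
  have "m * n - z = (u + 2) * z" unfolding z(1) u by (simp add: algebra_simps)
  then have p: "real (m * n - z) = (real u + 2) * real z" by (simp only: of_nat_mult of_nat_add of_nat_numeral)
  show "clique_join_gap (real (m div central_period * n)) (real (m * n - m div central_period * n)) (real central_period) (real (m div central_period * n)) \<ge> 0"
    unfolding z_def[symmetric] p using clique_join_gap_many_cliques[of "real z" "real u"] z(2)
    by (simp only: u of_nat_add of_nat_numeral)
  fix x y assume xy: "x \<in> carrier G - abelian_half" "y \<in> carrier G - abelian_half" "block central_period x = block central_period y"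
  obtain i j k l where "x = E i j" "odd j" "y = E k l" "odd l"
    using xy(1,2) by (metis outside_cases)
  then have "x \<otimes> y = y \<otimes> x"
    using xy(3) K3 by (simp add: block_eq_iff[OF central_period_dvd] commute_iff)
  then show "\<exists>x'\<in>Id_on (carrier G) `` {x}. \<exists>y'\<in>Id_on (carrier G) `` {y}. x' \<otimes> y' = y' \<otimes> x'"
    using xy by blast
qed (use assms in auto)

text \<open>The equation \<open>h = x g x\<^sup>-\<^sup>1\<close> is compared in the form \<open>h x = x g\<close>, which avoids inverses.\<close>

lemma conjugate_iff:
  "(E i j, E k l) \<in> conjugacy_rel G \<longleftrightarrow>
    (\<exists>t s. int m dvd k + twist l t - (t + twist s i) \<and> int (2 * n) dvd l - j)"
proof -
  have "(E i j, E k l) \<in> conjugacy_rel G \<longleftrightarrow> (\<exists>t s. E k l = E t s \<otimes> E i j \<otimes> inv (E t s))"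
    unfolding conjugacy_rel_def using carrier_E by auto
  also have "\<dots> \<longleftrightarrow> (\<exists>t s. E k l \<otimes> E t s = E t s \<otimes> E i j)"
    by (simp add: inv_solve_right eq_commute)
  also have "\<dots> \<longleftrightarrow> (\<exists>t s. int m dvd k + twist l t - (t + twist s i) \<and> int (2 * n) dvd l - j)"
    by (simp add: E_mult E_eq_iff)
  finally show ?thesis .
qed

lemma conjugate_parity: "(E i j, E k l) \<in> conjugacy_rel G \<Longrightarrow> even j \<longleftrightarrow> even l"
  unfolding conjugate_iff using even_if_double_dvd[of n "l - j"] by auto

lemma conjugate_shift: "odd j \<Longrightarrow> (E i j, E (i + 2 * t) j) \<in> conjugacy_rel G"
  unfolding conjugate_iff by (rule exI[of _ t], rule exI[of _ 0]) (simp add: twist_def)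

lemma conjugate_commuting:
  assumes "odd j" "odd l" "int central_period dvd i + 2 * t - k"
  shows "\<exists>x'\<in>conjugacy_rel G `` {E i j}. \<exists>y'\<in>conjugacy_rel G `` {E k l}. x' \<otimes> y' = y' \<otimes> x'"
proof (intro bexI)
  show "E (i + 2 * t) j \<otimes> E k l = E k l \<otimes> E (i + 2 * t) j"
    using assms by (simp add: commute_iff)
  show "E (i + 2 * t) j \<in> conjugacy_rel G `` {E i j}" using conjugate_shift assms by simp
  show "E k l \<in> conjugacy_rel G `` {E k l}" using conjugate_shift[of l k 0] assms by simp
qed

text \<open>Conjugation by \<open>a\<close> shifts the exponent of \<open>a\<close> by \<open>2\<close> outside the abelian half. Commuting elements there have
exponents that agree modulo the central period. If this period is odd, shifts by \<open>2\<close> reach every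
residue and one clique remains; if it is even, the parity of the exponent is invariant and separates two
cliques.\<close>

lemma hansen_vukicevic_CSCom:
  assumes "m \<ge> 3" "m \<noteq> 4" "n \<ge> 1"
  shows "hansen_vukicevic (CSCom G)"
proof (cases "even central_period")
  case False
  show ?thesis unfolding CSCom_def
  proof (rule hansen_vukicevic_one_block[OF _ assms(3) equiv_conjugacy_rel])
    fix x y assume "x \<in> carrier G - abelian_half" "y \<in> carrier G - abelian_half"
    then obtain i j k l where x: "x = E i j" "odd j" and y: "y = E k l" "odd l"
      by (metis outside_cases)
    obtain h where h: "int central_period = 2 * h + 1" using False by (metis even_of_nat oddE)
    \<comment> \<open>\<open>h + 1\<close> is the inverse of \<open>2\<close> modulo the odd number \<open>2 h + 1\<close>\<close>
    have "i + 2 * ((k - i) * (h + 1)) - k = int central_period * (k - i)" unfolding h by (simp add: algebra_simps)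
    then show "\<exists>x'\<in>conjugacy_rel G `` {x}. \<exists>y'\<in>conjugacy_rel G `` {y}. x' \<otimes> y' = y' \<otimes> x'"
      unfolding x(1) y(1) by (intro conjugate_commuting[where t = "(k - i) * (h + 1)"] x y) simp
  qed (use assms in simp)
next
  case True
  have m2: "2 dvd m" using True central_period_dvd by (rule dvd_trans)
  show ?thesis unfolding CSCom_def
  proof (rule hansen_vukicevic_equal_blocks[where e = 2])
    define z where "z = m div central_period * n"
    have z: "m * n = central_period * z" "z \<ge> 1" using centre_size assms by (simp_all add: z_def)
    obtain t where t: "central_period = 2 * t" using True by blast
    then have "t \<ge> 2" using central_period_ge_3 assms by simp
    then obtain u where u: "t = u + 2" by (metis add.commute le_iff_add)
    have "m * n - z = (2 * u + 3) * z" unfolding z(1) t u by (simp add: algebra_simps)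
    then have p: "real (m * n - z) = (2 * real u + 3) * real z"
      by (simp only: of_nat_mult of_nat_add of_nat_numeral)
    have "2 * (m div 2 * n) = 2 * ((u + 2) * z)" using z(1) m2 unfolding t u by auto
    then have "m div 2 * n = (u + 2) * z" by (simp only: mult_cancel1) simp
    then have q: "real (m div 2 * n) = (real u + 2) * real z"
      by (simp only: of_nat_mult of_nat_add of_nat_numeral)
    show "clique_join_gap (real (m div central_period * n)) (real (m * n - m div central_period * n)) (real 2) (real (m div 2 * n)) \<ge> 0"
      unfolding z_def[symmetric] p q using clique_join_gap_three_cliques[of "real z" "real u"] z(2)
      by simp
  next
    fix x y assume xy: "(x, y) \<in> conjugacy_rel G"
    then obtain i j k l where ij: "x = E i j" "y = E k l"
      unfolding conjugacy_rel_def by (auto elim!: carrier_cases)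
    show "x \<in> abelian_half \<Longrightarrow> y \<in> abelian_half" using conjugate_parity xy ij by simp
    have dvd: "\<exists>t s. int d dvd k + twist l t - (t + twist s i)" if "d dvd m" for d
      using xy that unfolding ij conjugate_iff by (meson dvd_trans int_dvd_int_iff)
    show "x \<in> centre" if "y \<in> centre"
    proof -
      have l: "even l" "even j" "int central_period dvd k" using that xy ij conjugate_parity by auto
      obtain t s where "int central_period dvd k + twist l t - (t + twist s i)" using dvd central_period_dvd by blast
      then have "int central_period dvd k - twist s i" using l by (simp add: twist_def)
      then have "int central_period dvd twist s i" using l(3) by (simp add: dvd_diff_right_iff)
      then show ?thesis using l ij by (simp add: twist_def split: if_splits)
    qed
    show "block 2 x = block 2 y" if "x \<in> carrier G - abelian_half" "y \<in> carrier G - abelian_half"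
    proof -
      obtain t s where "even (k + twist l t - (t + twist s i))" using dvd[OF m2] by auto
      then show ?thesis unfolding ij by (simp add: block_eq_iff[OF m2] twist_def split: if_splits; argo)
    qed
  next
    fix x y assume xy: "x \<in> carrier G - abelian_half" "y \<in> carrier G - abelian_half" "block 2 x = block 2 y"
    then obtain i j k l where x: "x = E i j" "odd j" and y: "y = E k l" "odd l"
      by (metis outside_cases)
    then have "even (k - i)" using xy(3) by (simp add: block_eq_iff[OF m2])
    then obtain t where "k - i = 2 * t" by blast
    then show "\<exists>x'\<in>conjugacy_rel G `` {x}. \<exists>y'\<in>conjugacy_rel G `` {y}. x' \<otimes> y' = y' \<otimes> x'"
      unfolding x(1) y(1) by (intro conjugate_commuting[where t = t] x y) (simp add: algebra_simps)
  qed (use assms True equiv_conjugacy_rel in auto)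
qed

lemma one_E: "\<one> = E 0 0"
proof -
  have "E 0 0 \<otimes> E 0 0 = E 0 0" by (simp add: E_mult twist_def)
  then show ?thesis using l_cancel_one[of "E 0 0" "E 0 0"] by simp
qed

lemma pow_odd:
  assumes "odd j"
  shows "E i j [^] (k :: nat) = E (if even k then 0 else i) (int k * j)"
proof (induction k)
  case (Suc k)
  then show ?case using assms by (simp add: E_mult twist_def algebra_simps)
qed (simp add: one_E)

text \<open>For odd \<open>j\<close> the square of \<open>a\<^sup>i b\<^sup>j\<close> is \<open>b\<^sup>2\<^sup>j\<close>, and odd powers are never trivial because the exponent of \<open>b\<close> stays
odd. Hence \<open>a\<^sup>i\<close> does not influence the order.\<close>

lemma ord_odd:
  assumes "odd j"
  shows "ord (E i j) = ord (E 0 j)"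
proof -
  have "E i j [^] k = \<one> \<longleftrightarrow> int (2 * n) dvd int k * j" for i and k :: nat
  proof -
    have "even k" if "int (2 * n) dvd int k * j"
    proof -
      have "even (int k * j)" using that by (rule even_if_double_dvd)
      then show ?thesis using assms by simp
    qed
    then show ?thesis by (auto simp: pow_odd[OF assms] one_E E_eq_iff)
  qed
  then have "ord (E i j) dvd k \<longleftrightarrow> ord (E 0 j) dvd k" for k
    by (simp add: pow_eq_id[symmetric])
  then show ?thesis by (meson dvd_antisym dvd_refl)
qed

text \<open>Every element outside the abelian half has the order of some power of \<open>b\<close>, and powers of \<open>b\<close> commute.\<close>

lemma hansen_vukicevic_OSCom:
  assumes "m \<ge> 2" "n \<ge> 1"
  shows "hansen_vukicevic (OSCom G)"
  unfolding OSCom_def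
proof (rule hansen_vukicevic_one_block[OF assms equiv_same_order_rel])
  fix x y assume "x \<in> carrier G - abelian_half" "y \<in> carrier G - abelian_half"
  then obtain i j k l where x: "x = E i j" "odd j" and y: "y = E k l" "odd l"
    by (metis outside_cases)
  have "E 0 j \<otimes> E 0 l = E 0 l \<otimes> E 0 j" using x y by (simp add: commute_iff)
  moreover have "E 0 j \<in> same_order_rel G `` {x}" "E 0 l \<in> same_order_rel G `` {y}"
    unfolding x(1) y(1) same_order_rel_def
    by (simp_all add: ord_odd[OF x(2), of i] ord_odd[OF y(2), of k])
  ultimately show "\<exists>x'\<in>same_order_rel G `` {x}. \<exists>y'\<in>same_order_rel G `` {y}. x' \<otimes> y' = y' \<otimes> x'"
    by blast
qed

end

theorem theorem3p8:
  fixes m n :: nat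
  assumes "m \<ge> 3" and "m \<noteq> 4" and "n \<ge> 1"
  shows "hansen_vukicevic (ESCom (M_group m n)) \<and>
         hansen_vukicevic (CSCom (M_group m n)) \<and>
         hansen_vukicevic (OSCom (M_group m n))"
proof -
  obtain E where "klein_coordinates (M_group m n) m n E"
    using klein_coordinates_M_group by blast
  then interpret klein_coordinates "M_group m n" m n E .
  show ?thesis
    using hansen_vukicevic_ESCom hansen_vukicevic_CSCom hansen_vukicevic_OSCom assms by simp
qed

end
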